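(* Let $\{(Q_i,M_i)\}_{i\in I}$ be a family of objects of the category $\mathcal{QM}$, and let $R=\coprod_{i\in I}Q_i$ be the coproduct of the $Q_i$ in the category of unital quantales, with coprojections $\nu_i\colon Q_i\to R$. For each $i$, regard $R$ as a right $Q_i$-module via $r\cdot a=r\,\nu_i(a)$, form the tensor product $R\otimes_{Q_i}M_i$ (a left $R$-module via $r\cdot(s\otimes x)=(rs)\otimes x$), and let $1\otimes\iota_{M_i}\colon M_i\to R\otimes_{Q_i}M_i$, $x\mapsto 1\otimes x$ (a $Q_i$-module morphism into the restriction of scalars along $\nu_i$). Let $\coprod_{i\in I}R\otimes_{Q_i}M_i$ be the coproduct of the family $\{R\otimes_{Q_i}M_i\}_{i\in I}$ in the category of left $R$-modules, with canonical $R$-module morphisms $\mu_i\colon R\otimes_{Q_i}M_i\to\coprod_{j\in I}R\otimes_{Q_j}M_j$. Then the coproduct of the family $\{(Q_i,M_i)\}_{i\in I}$ in $\mathcal{QM}$ is $$\Bigl(R,\ \coprod_{i\in I}R\otimes_{Q_i}M_i\Bigr)$$ with coprojections $(\nu_i,\ \mu_i\circ(1\otimes\iota_{M_i}))$, $i\in I$.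
   Context: A sup-lattice is a complete lattice; sup-lattice morphisms are maps preserving arbitrary joins. A (unital) quantale $\langle Q,\bigvee,\cdot,1\rangle$ is a sup-lattice with a monoid structure whose multiplication distributes over arbitrary joins on both sides; quantale homomorphisms preserve arbitrary joins, multiplication and unit. A left $Q$-module is a sup-lattice $M$ with an action $Q\times M\to M$ satisfying $(ab)x=a(bx)$, $1x=x$ and distributing over arbitrary joins in each argument; right modules are defined symmetrically. A $Q$-module morphism is a join-preserving map commuting with the action. If $h\colon Q\to R$ is a quantale homomorphism and $N$ is a left $R$-module, $N_h$ denotes the left $Q$-module with the same sup-lattice and action $a\cdot_h x=h(a)\cdot x$ (restriction of scalars). For a right $Q$-module $M_1$ and left $Q$-module $M_2$, the tensor product $M_1\otimes_Q M_2$ is the quotient of the free sup-lattice $\wp(M_1\times M_2)$ by the sup-lattice congruence generated by the pairs $(\{(\bigvee X,y)\},\{(x,y):x\in X\})$, $(\{(x,\bigvee Y)\},\{(x,y):y\in Y\})$, $(\{(xa,y)\},\{(x,ay)\})$; $x\otimes y$ is the class of $\{(x,y)\}$. The category $\mathcal{QM}$ has as objects pairs $(Q,M)$ with $Q$ a unital quantale and $M$ a left $Q$-module; a morphism $(Q,M)\to(R,N)$ is a pair $(h,f)$ with $h\colon Q\to R$ a unital quantale homomorphism and $f\colon M\to N_h$ a $Q$-module morphism; composition is componentwise. *)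

theory Defs
  imports "HOL-Algebra.Group"
begin

section \<open>Unital quantales and modules over them\<close>

text \<open>
  Sup-lattices are complete lattices (\<^locale>\<open>complete_lattice\<close>), and a map preserves arbitrary joins
  if it satisfies \<^const>\<open>sup_pres\<close> (the empty join is included).
  Morphisms are extensional functions on carriers (\<open>\<rightarrow>\<^sub>E\<close>) and are composed with
  \<^const>\<open>compose\<close>, so that equality of morphisms is equality in HOL.
\<close>

record 'a quantale = "'a gorder" +
  qmult :: "'a \<Rightarrow> 'a \<Rightarrow> 'a" (infixl \<open>\<cdot>\<index>\<close> 70)
  qone :: 'a

locale quantale = complete_lattice Q for Q :: "('a, 'b) quantale_scheme" (structure) +
  assumes qmonoid: "monoid \<lparr>carrier = carrier Q, mult = qmult Q, one = qone Q\<rparr>"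
    and qmult_Sup_right:
      "\<lbrakk>a \<in> carrier Q; B \<subseteq> carrier Q\<rbrakk> \<Longrightarrow> a \<cdot> (\<Squnion>B) = \<Squnion>((\<lambda>b. a \<cdot> b) ` B)"
    and qmult_Sup_left:
      "\<lbrakk>A \<subseteq> carrier Q; b \<in> carrier Q\<rbrakk> \<Longrightarrow> (\<Squnion>A) \<cdot> b = \<Squnion>((\<lambda>a. a \<cdot> b) ` A)"

definition quantale_hom :: "'a quantale \<Rightarrow> 'b quantale \<Rightarrow> ('a \<Rightarrow> 'b) set" where
  "quantale_hom Q R =
     {h \<in> carrier Q \<rightarrow>\<^sub>E carrier R.
        sup_pres Q R h \<and>
        (\<forall>a\<in>carrier Q. \<forall>b\<in>carrier Q. h (a \<cdot>\<^bsub>Q\<^esub> b) = h a \<cdot>\<^bsub>R\<^esub> h b) \<and>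
        h (qone Q) = qone R}"

record ('q, 'm) left_qmodule = "'m gorder" +
  lact :: "'q \<Rightarrow> 'm \<Rightarrow> 'm" (infixr \<open>\<bullet>\<index>\<close> 75)

locale left_qmodule = Q: quantale Q + M: complete_lattice M
  for Q :: "('q, 'b) quantale_scheme" and M :: "('q, 'm, 'c) left_qmodule_scheme" +
  assumes lact_closed:
      "\<lbrakk>a \<in> carrier Q; x \<in> carrier M\<rbrakk> \<Longrightarrow> a \<bullet>\<^bsub>M\<^esub> x \<in> carrier M"
    and lact_mult:
      "\<lbrakk>a \<in> carrier Q; b \<in> carrier Q; x \<in> carrier M\<rbrakk>
        \<Longrightarrow> (a \<cdot>\<^bsub>Q\<^esub> b) \<bullet>\<^bsub>M\<^esub> x = a \<bullet>\<^bsub>M\<^esub> (b \<bullet>\<^bsub>M\<^esub> x)"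
    and lact_one: "x \<in> carrier M \<Longrightarrow> qone Q \<bullet>\<^bsub>M\<^esub> x = x"
    and lact_Sup_right:
      "\<lbrakk>a \<in> carrier Q; X \<subseteq> carrier M\<rbrakk>
        \<Longrightarrow> a \<bullet>\<^bsub>M\<^esub> (\<Squnion>\<^bsub>M\<^esub>X) = \<Squnion>\<^bsub>M\<^esub>((\<lambda>x. a \<bullet>\<^bsub>M\<^esub> x) ` X)"
    and lact_Sup_left:
      "\<lbrakk>A \<subseteq> carrier Q; x \<in> carrier M\<rbrakk>
        \<Longrightarrow> (\<Squnion>\<^bsub>Q\<^esub>A) \<bullet>\<^bsub>M\<^esub> x = \<Squnion>\<^bsub>M\<^esub>((\<lambda>a. a \<bullet>\<^bsub>M\<^esub> x) ` A)"

definition qmodule_hom ::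
  "'q quantale \<Rightarrow> ('q, 'm) left_qmodule \<Rightarrow> ('q, 'n) left_qmodule \<Rightarrow> ('m \<Rightarrow> 'n) set" where
  "qmodule_hom Q M N =
     {f \<in> carrier M \<rightarrow>\<^sub>E carrier N.
        sup_pres M N f \<and>
        (\<forall>a\<in>carrier Q. \<forall>x\<in>carrier M. f (a \<bullet>\<^bsub>M\<^esub> x) = a \<bullet>\<^bsub>N\<^esub> f x)}"

definition restrict_scalars ::
  "('q \<Rightarrow> 'r) \<Rightarrow> ('r, 'n) left_qmodule \<Rightarrow> ('q, 'n) left_qmodule" where
  "restrict_scalars h N =
     \<lparr>carrier = carrier N, eq = eq N, le = le N, lact = (\<lambda>a x. h a \<bullet>\<^bsub>N\<^esub> x)\<rparr>"

record ('m, 'q) right_qmodule = "'m gorder" +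
  ract :: "'m \<Rightarrow> 'q \<Rightarrow> 'm" (infixl \<open>\<star>\<index>\<close> 75)

text \<open>The quantale \<open>R\<close> as a right module along \<open>\<nu>\<close>, with \<open>r \<star> a = r \<cdot> \<nu> a\<close>.\<close>

definition right_regular :: "'r quantale \<Rightarrow> ('q \<Rightarrow> 'r) \<Rightarrow> ('r, 'q) right_qmodule" where
  "right_regular R \<nu> =
     \<lparr>carrier = carrier R, eq = eq R, le = le R, ract = (\<lambda>r a. r \<cdot>\<^bsub>R\<^esub> \<nu> a)\<rparr>"


section \<open>Sup-lattice congruences and quotients\<close>

text \<open>
  Compatibility with arbitrary joins: a family of related pairs is given by the set \<open>Z\<close> of these
  pairs, and the joins of its first and of its second components have to be related.
\<close>

definition sup_congruence :: "('a, 'b) gorder_scheme \<Rightarrow> 'a rel \<Rightarrow> bool" where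
  "sup_congruence L \<theta> \<longleftrightarrow>
     equiv (carrier L) \<theta> \<and> (\<forall>Z\<subseteq>\<theta>. (\<Squnion>\<^bsub>L\<^esub>(fst ` Z), \<Squnion>\<^bsub>L\<^esub>(snd ` Z)) \<in> \<theta>)"

definition generated_sup_congruence :: "('a, 'b) gorder_scheme \<Rightarrow> 'a rel \<Rightarrow> 'a rel" where
  "generated_sup_congruence L G = \<Inter>{\<theta>. sup_congruence L \<theta> \<and> G \<subseteq> \<theta>}"

text \<open>
  The quotient order is the one induced by the joins of the quotient:
  \<open>[x] \<le> [y]\<close> iff \<open>[x \<squnion> y] = [y]\<close>.
\<close>

definition quotient_sup_lattice :: "('a, 'b) gorder_scheme \<Rightarrow> 'a rel \<Rightarrow> 'a set gorder" where
  "quotient_sup_lattice L \<theta> =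
     \<lparr>carrier = carrier L // \<theta>, eq = (=), le = (\<lambda>C D. \<forall>x\<in>C. \<forall>y\<in>D. x \<squnion>\<^bsub>L\<^esub> y \<in> D)\<rparr>"

definition free_sup_lattice :: "'a set \<Rightarrow> 'a set gorder" where
  "free_sup_lattice A = \<lparr>carrier = Pow A, eq = (=), le = (\<subseteq>)\<rparr>"


section \<open>Tensor products and extension of scalars\<close>

definition tensor_relations ::
  "'q quantale \<Rightarrow> ('x, 'q) right_qmodule \<Rightarrow> ('q, 'y) left_qmodule \<Rightarrow> ('x \<times> 'y) set rel" where
  "tensor_relations Q M1 M2 =
     {({(\<Squnion>\<^bsub>M1\<^esub>X, y)}, {(x, y) |x. x \<in> X}) |X y. X \<subseteq> carrier M1 \<and> y \<in> carrier M2} \<union>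
     {({(x, \<Squnion>\<^bsub>M2\<^esub>Y)}, {(x, y) |y. y \<in> Y}) |x Y. x \<in> carrier M1 \<and> Y \<subseteq> carrier M2} \<union>
     {({(x \<star>\<^bsub>M1\<^esub> a, y)}, {(x, a \<bullet>\<^bsub>M2\<^esub> y)}) |x a y.
        x \<in> carrier M1 \<and> a \<in> carrier Q \<and> y \<in> carrier M2}"

definition tensor_congruence ::
  "'q quantale \<Rightarrow> ('x, 'q) right_qmodule \<Rightarrow> ('q, 'y) left_qmodule \<Rightarrow> ('x \<times> 'y) set rel" where
  "tensor_congruence Q M1 M2 =
     generated_sup_congruence (free_sup_lattice (carrier M1 \<times> carrier M2))
       (tensor_relations Q M1 M2)"

definition tensor_product ::
  "'q quantale \<Rightarrow> ('x, 'q) right_qmodule \<Rightarrow> ('q, 'y) left_qmodule \<Rightarrow> ('x \<times> 'y) set set gorder" where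
  "tensor_product Q M1 M2 =
     quotient_sup_lattice (free_sup_lattice (carrier M1 \<times> carrier M2)) (tensor_congruence Q M1 M2)"

definition elementary_tensor ::
  "'q quantale \<Rightarrow> ('x, 'q) right_qmodule \<Rightarrow> ('q, 'y) left_qmodule \<Rightarrow> 'x \<Rightarrow> 'y \<Rightarrow> ('x \<times> 'y) set set"
  where "elementary_tensor Q M1 M2 x y = tensor_congruence Q M1 M2 `` {{(x, y)}}"

text \<open>
  \<open>R \<otimes>\<^sub>Q M\<close> as a left \<open>R\<close>-module. The action is the join-preserving extension of
  \<open>r \<cdot> (s \<otimes> x) = (r \<cdot> s) \<otimes> x\<close>: the class \<open>C\<close> of \<open>X\<close> is the join of the \<open>s \<otimes> x\<close> with
  \<open>(s, x) \<in> X\<close>, and is sent to the class of \<open>{(r \<cdot> s, x) | (s, x) \<in> X}\<close>. This class does not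
  depend on the representative \<open>X\<close>, so the union over \<open>X \<in> C\<close> is that class.
\<close>

definition extend_scalars ::
  "'q quantale \<Rightarrow> 'r quantale \<Rightarrow> ('q \<Rightarrow> 'r) \<Rightarrow> ('q, 'm) left_qmodule
    \<Rightarrow> ('r, ('r \<times> 'm) set set) left_qmodule" where
  "extend_scalars Q R \<nu> M =
     (let T = tensor_product Q (right_regular R \<nu>) M in
      \<lparr>carrier = carrier T, eq = eq T, le = le T,
       lact = (\<lambda>r C. \<Union>X\<in>C. tensor_congruence Q (right_regular R \<nu>) M
                               `` {(\<lambda>(s, x). (r \<cdot>\<^bsub>R\<^esub> s, x)) ` X})\<rparr>)"

definition extend_scalars_unit ::
  "'q quantale \<Rightarrow> 'r quantale \<Rightarrow> ('q \<Rightarrow> 'r) \<Rightarrow> ('q, 'm) left_qmodule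
    \<Rightarrow> 'm \<Rightarrow> ('r \<times> 'm) set set" where
  "extend_scalars_unit Q R \<nu> M =
     (\<lambda>x\<in>carrier M. elementary_tensor Q (right_regular R \<nu>) M (qone R) x)"


section \<open>The category QM\<close>

definition QM_object :: "'q quantale \<times> ('q, 'm) left_qmodule \<Rightarrow> bool" where
  "QM_object = (\<lambda>(Q, M). quantale Q \<and> left_qmodule Q M)"

definition QM_hom ::
  "'q quantale \<times> ('q, 'm) left_qmodule \<Rightarrow> 'r quantale \<times> ('r, 'n) left_qmodule
    \<Rightarrow> (('q \<Rightarrow> 'r) \<times> ('m \<Rightarrow> 'n)) set" where
  "QM_hom = (\<lambda>(Q, M) (R, N).
     {(h, f). h \<in> quantale_hom Q R \<and> f \<in> qmodule_hom Q M (restrict_scalars h N)})"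

text \<open>\<open>QM_compose A v u\<close> is \<open>v \<circ> u\<close>, where \<open>A\<close> is the domain of \<open>u\<close>.\<close>

definition QM_compose ::
  "'q quantale \<times> ('q, 'm) left_qmodule \<Rightarrow> ('r \<Rightarrow> 's) \<times> ('n \<Rightarrow> 'p) \<Rightarrow> ('q \<Rightarrow> 'r) \<times> ('m \<Rightarrow> 'n)
    \<Rightarrow> ('q \<Rightarrow> 's) \<times> ('m \<Rightarrow> 'p)" where
  "QM_compose = (\<lambda>(Q, M) (k, g) (h, f). (compose (carrier Q) k h, compose (carrier M) g f))"


section \<open>Coproducts\<close>

text \<open>
  HOL cannot quantify over types inside a formula. Each universal property therefore takes, as a
  type argument, the type in which the carriers of the test objects lie; a coproduct is an object
  with coprojections that has the universal property for every choice of this type argument.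
\<close>

definition quantale_coproduct ::
  "'s itself \<Rightarrow> 'i set \<Rightarrow> ('i \<Rightarrow> 'q quantale) \<Rightarrow> 'r quantale \<Rightarrow> ('i \<Rightarrow> 'q \<Rightarrow> 'r) \<Rightarrow> bool" where
  "quantale_coproduct (T :: 's itself) I Q R \<nu> \<longleftrightarrow>
     quantale R \<and> (\<forall>i\<in>I. \<nu> i \<in> quantale_hom (Q i) R) \<and>
     (\<forall>(S :: 's quantale) h. quantale S \<and> (\<forall>i\<in>I. h i \<in> quantale_hom (Q i) S) \<longrightarrow>
        (\<exists>!k. k \<in> quantale_hom R S \<and> (\<forall>i\<in>I. compose (carrier (Q i)) k (\<nu> i) = h i)))"

definition qmodule_coproduct ::
  "'n itself \<Rightarrow> 'r quantale \<Rightarrow> 'i set \<Rightarrow> ('i \<Rightarrow> ('r, 'm) left_qmodule) \<Rightarrow> ('r, 'p) left_qmodule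
    \<Rightarrow> ('i \<Rightarrow> 'm \<Rightarrow> 'p) \<Rightarrow> bool" where
  "qmodule_coproduct (T :: 'n itself) R I M P \<mu> \<longleftrightarrow>
     left_qmodule R P \<and> (\<forall>i\<in>I. \<mu> i \<in> qmodule_hom R (M i) P) \<and>
     (\<forall>(N :: ('r, 'n) left_qmodule) f.
        left_qmodule R N \<and> (\<forall>i\<in>I. f i \<in> qmodule_hom R (M i) N) \<longrightarrow>
        (\<exists>!g. g \<in> qmodule_hom R P N \<and> (\<forall>i\<in>I. compose (carrier (M i)) g (\<mu> i) = f i)))"

definition QM_coproduct ::
  "'s itself \<Rightarrow> 'n itself \<Rightarrow> 'i set \<Rightarrow> ('i \<Rightarrow> 'q quantale \<times> ('q, 'm) left_qmodule)
    \<Rightarrow> 'r quantale \<times> ('r, 'p) left_qmodule \<Rightarrow> ('i \<Rightarrow> ('q \<Rightarrow> 'r) \<times> ('m \<Rightarrow> 'p)) \<Rightarrow> bool" where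
  "QM_coproduct (T :: 's itself) (T' :: 'n itself) I A B \<kappa> \<longleftrightarrow>
     QM_object B \<and> (\<forall>i\<in>I. \<kappa> i \<in> QM_hom (A i) B) \<and>
     (\<forall>(C :: 's quantale \<times> ('s, 'n) left_qmodule) u.
        QM_object C \<and> (\<forall>i\<in>I. u i \<in> QM_hom (A i) C) \<longrightarrow>
        (\<exists>!w. w \<in> QM_hom B C \<and> (\<forall>i\<in>I. QM_compose (A i) w (\<kappa> i) = u i)))"

end

theory Submission
  imports Defs
begin

text \<open>
  Extension of scalars along \<open>\<nu>\<close> is left adjoint to restriction of scalars: a \<open>Q\<close>-morphism
  \<open>f : M \<rightarrow> N\<^sub>\<nu>\<close> extends uniquely to the \<open>R\<close>-morphism \<open>r \<otimes> x \<mapsto> r \<cdot> f x\<close> on \<open>R \<otimes>\<^sub>Q M\<close>. Given a cocone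
  \<open>(h\<^sub>i, f\<^sub>i)\<close> with vertex \<open>(S, N)\<close>, the coproduct of quantales yields \<open>k : R \<rightarrow> S\<close> with \<open>k \<circ> \<nu>\<^sub>i = h\<^sub>i\<close>,
  so each \<open>f\<^sub>i\<close> is a \<open>Q\<^sub>i\<close>-morphism into the restriction of \<open>N\<^sub>k\<close> along \<open>\<nu>\<^sub>i\<close>. The adjunction turns the
  \<open>f\<^sub>i\<close> into \<open>R\<close>-morphisms \<open>R \<otimes> M\<^sub>i \<rightarrow> N\<^sub>k\<close>, and the coproduct of \<open>R\<close>-modules glues these.
\<close>

section \<open>Complete lattices and their quotients\<close>

lemma sup_gorder_cong:
  assumes "carrier L = carrier L'" "le L = le L'"
  shows "\<Squnion>\<^bsub>L\<^esub>A = \<Squnion>\<^bsub>L'\<^esub>A"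
  using assms by (simp add: sup_def least_def Upper_def)

text \<open>The meet of \<open>A\<close> is the join of the set of its lower bounds. Hence only
  joins have to be constructed for the quotient and for the free sup-lattice.\<close>

lemma (in partial_order) complete_lattice_if_sups:
  assumes sups: "\<And>A. A \<subseteq> carrier L \<Longrightarrow> \<exists>s. least L s (Upper L A)"
  shows "complete_lattice L"
proof unfold_locales
  fix A assume A: "A \<subseteq> carrier L"
  show "\<exists>s. least L s (Upper L A)"
    by (rule sups[OF A])
  obtain i where i: "least L i (Upper L (Lower L A))"
    using sups[of "Lower L A"] by auto
  have "greatest L i (Lower L A)"
    using i A by (auto simp: greatest_def least_def Upper_def Lower_def)
  then show "\<exists>i. greatest L i (Lower L A)" ..
qed

text \<open>The two records may carry different further fields. This moves completeness from a bare
  order to the module built on it, and between a module and its restriction of scalars.\<close>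

lemma complete_lattice_gorder_cong:
  assumes "complete_lattice L" "carrier L = carrier L'" "le L = le L'" "eq L = eq L'"
  shows "complete_lattice L'"
proof -
  interpret L: complete_lattice L by fact
  interpret L': partial_order L'
    by unfold_locales
      (simp_all add: assms(2-4)[symmetric] L.eq_is_equal, (rule L.le_antisym; assumption),
        (rule L.le_trans; assumption))
  show ?thesis
  proof (rule L'.complete_lattice_if_sups)
    fix A assume "A \<subseteq> carrier L'"
    then show "\<exists>s. least L' s (Upper L' A)"
      using L.sup_exists[of A] assms by (simp add: least_def Upper_def)
  qed
qed

lemma (in complete_lattice) sup_eqI:
  assumes "A \<subseteq> carrier L" "s \<in> carrier L" "\<And>x. x \<in> A \<Longrightarrow> x \<sqsubseteq> s"
    and "\<And>u. u \<in> carrier L \<Longrightarrow> (\<And>x. x \<in> A \<Longrightarrow> x \<sqsubseteq> u) \<Longrightarrow> s \<sqsubseteq> u"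
  shows "\<Squnion>A = s"
  by (meson assms le_antisym sup_closed sup_least sup_upper)

lemma (in complete_lattice) sup_Union:
  assumes "\<And>X. X \<in> \<X> \<Longrightarrow> X \<subseteq> carrier L"
  shows "\<Squnion>(\<Union>\<X>) = \<Squnion>((\<lambda>X. \<Squnion>X) ` \<X>)"
proof (rule sup_eqI)
  show "\<Union>\<X> \<subseteq> carrier L" and mem: "\<Squnion>((\<lambda>X. \<Squnion>X) ` \<X>) \<in> carrier L"
    using assms by (auto intro!: sup_closed)
  show "x \<sqsubseteq> \<Squnion>((\<lambda>X. \<Squnion>X) ` \<X>)" if x: "x \<in> \<Union>\<X>" for x
  proof -
    obtain X where X: "X \<in> \<X>" "x \<in> X" using x by blast
    have "x \<sqsubseteq> \<Squnion>X" using X assms by (auto intro: sup_upper)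
    moreover have "\<Squnion>X \<sqsubseteq> \<Squnion>((\<lambda>X. \<Squnion>X) ` \<X>)"
      using X assms by (auto intro!: sup_upper)
    ultimately show ?thesis
      using X assms mem by (meson le_trans subsetD sup_closed)
  qed
  show "\<Squnion>((\<lambda>X. \<Squnion>X) ` \<X>) \<sqsubseteq> u" if "u \<in> carrier L" "\<And>x. x \<in> \<Union>\<X> \<Longrightarrow> x \<sqsubseteq> u" for u
    using that assms by (auto intro!: sup_least)
qed

lemma sup_pres_sup:
  "\<lbrakk>sup_pres X Y f; A \<subseteq> carrier X\<rbrakk> \<Longrightarrow> f (\<Squnion>\<^bsub>X\<^esub>A) = \<Squnion>\<^bsub>Y\<^esub>(f ` A)"
  by (simp add: sup_pres_def)

lemma sup_pres_compose:
  assumes f: "sup_pres X Y f" "f \<in> carrier X \<rightarrow> carrier Y" and g: "sup_pres Y Z g"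
  shows "sup_pres X Z (compose (carrier X) g f)"
proof -
  interpret X: complete_lattice X using f(1) by (simp add: sup_pres_def)
  have "compose (carrier X) g f (\<Squnion>\<^bsub>X\<^esub>A) = \<Squnion>\<^bsub>Z\<^esub>(compose (carrier X) g f ` A)"
    if A: "A \<subseteq> carrier X" for A
  proof -
    have "compose (carrier X) g f (\<Squnion>\<^bsub>X\<^esub>A) = g (f (\<Squnion>\<^bsub>X\<^esub>A))"
      using A by (simp add: compose_eq)
    also have "\<dots> = \<Squnion>\<^bsub>Z\<^esub>(g ` f ` A)"
      using A f(2) by (auto simp: sup_pres_sup[OF f(1)] intro: sup_pres_sup[OF g])
    also have "g ` f ` A = compose (carrier X) g f ` A"
      using A by (force simp: compose_eq)
    finally show ?thesis .
  qed
  then show ?thesis using f(1) g by (simp add: sup_pres_def)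
qed

text \<open>Together with \<open>generated_sup_congruence_least\<close> this reduces factoring a
  join-preserving map through a generated quotient to checking that it identifies each generating
  pair.\<close>

lemma sup_congruence_kernel:
  assumes F: "sup_pres L N F"
  shows "sup_congruence L {(x, y). x \<in> carrier L \<and> y \<in> carrier L \<and> F x = F y}"
    (is "sup_congruence L ?K")
proof -
  interpret L: complete_lattice L using F by (simp add: sup_pres_def)
  have "(\<Squnion>\<^bsub>L\<^esub>(fst ` Z), \<Squnion>\<^bsub>L\<^esub>(snd ` Z)) \<in> ?K" if Z: "Z \<subseteq> ?K" for Z
  proof -
    have sub: "fst ` Z \<subseteq> carrier L" "snd ` Z \<subseteq> carrier L" using Z by auto
    have "F ` fst ` Z = F ` snd ` Z"
      unfolding image_image using Z by (intro image_cong) auto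
    then have "F (\<Squnion>\<^bsub>L\<^esub>(fst ` Z)) = F (\<Squnion>\<^bsub>L\<^esub>(snd ` Z))"
      using F sub by (simp add: sup_pres_sup)
    then show ?thesis using sub by simp
  qed
  moreover have "equiv (carrier L) ?K"
    by (rule equivI) (auto simp: refl_on_def sym_def trans_def)
  ultimately show ?thesis by (simp add: sup_congruence_def)
qed

lemma generated_sup_congruence_least:
  "\<lbrakk>sup_congruence L \<theta>; G \<subseteq> \<theta>\<rbrakk> \<Longrightarrow> generated_sup_congruence L G \<subseteq> \<theta>"
  by (auto simp: generated_sup_congruence_def)

lemma generators_subset_generated_sup_congruence:
  "G \<subseteq> generated_sup_congruence L G"
  by (auto simp: generated_sup_congruence_def)

text \<open>
  Without the assumption on \<open>G\<close> there might be no congruence containing \<open>G\<close>, and the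
  intersection would be \<open>UNIV\<close>.
\<close>

lemma (in complete_lattice) sup_congruence_generated:
  assumes G: "G \<subseteq> carrier L \<times> carrier L"
  shows "sup_congruence L (generated_sup_congruence L G)"
proof -
  let ?\<Theta> = "{\<theta>. sup_congruence L \<theta> \<and> G \<subseteq> \<theta>}"
  have eqv: "equiv (carrier L) \<theta>" if "\<theta> \<in> ?\<Theta>" for \<theta>
    using that by (simp add: sup_congruence_def)
  have all: "carrier L \<times> carrier L \<in> ?\<Theta>"
    using G by (auto simp: sup_congruence_def equiv_def refl_on_def sym_def trans_def
        intro!: sup_closed)
  have "equiv (carrier L) (\<Inter>?\<Theta>)"
  proof (rule equivI)
    show "\<Inter>?\<Theta> \<subseteq> carrier L \<times> carrier L" using all by blast
    show "refl_on (carrier L) (\<Inter>?\<Theta>)"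
      using eqv by (auto simp: refl_on_def equiv_def)
    show "sym (\<Inter>?\<Theta>)"
      using eqv by (auto simp: sym_def equiv_def)
    show "trans (\<Inter>?\<Theta>)"
      using eqv unfolding trans_def equiv_def by blast
  qed
  moreover have "(\<Squnion>(fst ` Z), \<Squnion>(snd ` Z)) \<in> \<Inter>?\<Theta>" if "Z \<subseteq> \<Inter>?\<Theta>" for Z
  proof
    fix \<theta> assume "\<theta> \<in> ?\<Theta>"
    moreover from this have "Z \<subseteq> \<theta>" using that by blast
    ultimately show "(\<Squnion>(fst ` Z), \<Squnion>(snd ` Z)) \<in> \<theta>" by (simp add: sup_congruence_def)
  qed
  ultimately show ?thesis
    unfolding sup_congruence_def generated_sup_congruence_def by blast
qed

section \<open>The quotient of a complete lattice by a sup-congruence\<close>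

locale sup_lattice_quotient = complete_lattice L for L (structure) +
  fixes \<theta>
  assumes congruence: "sup_congruence L \<theta>"
begin

lemma equivalence: "equiv (carrier L) \<theta>"
  using congruence by (simp add: sup_congruence_def)

lemma related_carrier: "(x, y) \<in> \<theta> \<Longrightarrow> x \<in> carrier L \<and> y \<in> carrier L"
  using equivalence by (auto simp: equiv_def)

lemma related_refl: "x \<in> carrier L \<Longrightarrow> (x, x) \<in> \<theta>"
  using equivalence by (auto simp: equiv_def refl_on_def)

lemma related_sym: "(x, y) \<in> \<theta> \<Longrightarrow> (y, x) \<in> \<theta>"
  using equivalence by (auto simp: equiv_def elim: symD)

lemma related_trans: "\<lbrakk>(x, y) \<in> \<theta>; (y, z) \<in> \<theta>\<rbrakk> \<Longrightarrow> (x, z) \<in> \<theta>"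
  using equivalence by (auto simp: equiv_def elim: transD)

lemma class_eq_iff:
  "\<lbrakk>x \<in> carrier L; y \<in> carrier L\<rbrakk> \<Longrightarrow> \<theta> `` {x} = \<theta> `` {y} \<longleftrightarrow> (x, y) \<in> \<theta>"
  using equivalence by (simp add: eq_equiv_class_iff)

text \<open>\<open>sup_congruence\<close> speaks of a set of pairs. The indexed form follows by
  taking for this set the range of \<open>(f i, g i)\<close>, whose projections are the two
  images.\<close>

lemma related_sup_image:
  assumes "\<And>i. i \<in> J \<Longrightarrow> (f i, g i) \<in> \<theta>"
  shows "(\<Squnion>(f ` J), \<Squnion>(g ` J)) \<in> \<theta>"
proof -
  have "(\<lambda>i. (f i, g i)) ` J \<subseteq> \<theta>" using assms by auto
  then have "(\<Squnion>(fst ` (\<lambda>i. (f i, g i)) ` J), \<Squnion>(snd ` (\<lambda>i. (f i, g i)) ` J)) \<in> \<theta>"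
    using congruence unfolding sup_congruence_def by blast
  then show ?thesis by (simp add: image_image)
qed

lemma related_join:
  assumes "(x, x') \<in> \<theta>" "(y, y') \<in> \<theta>"
  shows "(x \<squnion> y, x' \<squnion> y') \<in> \<theta>"
  \<comment> \<open>A binary join is a join indexed by the booleans.\<close>
  using related_sup_image[of "{True, False}" "\<lambda>b. if b then x else y" "\<lambda>b. if b then x' else y'"]
    assms by (simp add: join_def insert_commute)

abbreviation quot :: "'a set gorder"
  where "quot \<equiv> quotient_sup_lattice L \<theta>"

lemma carrier_quot: "carrier quot = (\<lambda>x. \<theta> `` {x}) ` carrier L"
  by (auto simp: quotient_sup_lattice_def quotient_def)

text \<open>The order on classes quantifies over all representatives. Since \<theta> respects binary
  joins, a single pair of representatives decides it.\<close>

lemma le_quot_iff: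
  assumes "x \<in> carrier L" "y \<in> carrier L"
  shows "\<theta> `` {x} \<sqsubseteq>\<^bsub>quot\<^esub> \<theta> `` {y} \<longleftrightarrow> (x \<squnion> y, y) \<in> \<theta>"
proof -
  have refl: "(x, x) \<in> \<theta>" "(y, y) \<in> \<theta>"
    using assms by (simp_all add: related_refl)
  have "(y, x' \<squnion> y') \<in> \<theta>" if xy: "(x \<squnion> y, y) \<in> \<theta>" and "(x, x') \<in> \<theta>" "(y, y') \<in> \<theta>" for x' y'
    using that by (meson related_join related_sym related_trans)
  moreover have "(x \<squnion> y, y) \<in> \<theta>" if "(y, x \<squnion> y) \<in> \<theta>"
    using that by (rule related_sym)
  ultimately show ?thesis
    using refl by (auto simp: quotient_sup_lattice_def)
qed

lemma class_mono:
  assumes "x \<in> carrier L" "y \<in> carrier L" "x \<sqsubseteq> y"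
  shows "\<theta> `` {x} \<sqsubseteq>\<^bsub>quot\<^esub> \<theta> `` {y}"
proof -
  have "x \<squnion> y = y"
    using assms by (meson join_le join_closed join_right le_antisym le_refl)
  then show ?thesis
    using assms by (simp add: le_quot_iff related_refl)
qed

lemma partial_order_quot: "partial_order quot"
proof -
  have antisym: "C = D" if C: "C \<in> carrier quot" and D: "D \<in> carrier quot"
    and le: "C \<sqsubseteq>\<^bsub>quot\<^esub> D" "D \<sqsubseteq>\<^bsub>quot\<^esub> C" for C D
  proof -
    obtain x y where xy: "x \<in> carrier L" "y \<in> carrier L" "C = \<theta> `` {x}" "D = \<theta> `` {y}"
      using C D by (auto simp: carrier_quot)
    have "(x \<squnion> y, y) \<in> \<theta>" "(y \<squnion> x, x) \<in> \<theta>"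
      using le xy by (simp_all add: le_quot_iff)
    moreover have "y \<squnion> x = x \<squnion> y" by (simp add: join_def insert_commute)
    ultimately have "(x, y) \<in> \<theta>"
      by (metis related_sym related_trans)
    then show ?thesis using xy by (simp add: class_eq_iff)
  qed
  have trans: "C \<sqsubseteq>\<^bsub>quot\<^esub> E" if C: "C \<in> carrier quot" and D: "D \<in> carrier quot" and E: "E \<in> carrier quot"
    and le: "C \<sqsubseteq>\<^bsub>quot\<^esub> D" "D \<sqsubseteq>\<^bsub>quot\<^esub> E" for C D E
  proof -
    obtain x y z where xyz: "x \<in> carrier L" "y \<in> carrier L" "z \<in> carrier L"
      "C = \<theta> `` {x}" "D = \<theta> `` {y}" "E = \<theta> `` {z}"
      using C D E by (auto simp: carrier_quot)
    have xy: "(x \<squnion> y, y) \<in> \<theta>" and yz: "(y \<squnion> z, z) \<in> \<theta>"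
      using le xyz by (simp_all add: le_quot_iff)
    have refl: "(x, x) \<in> \<theta>" "(z, z) \<in> \<theta>"
      using xyz by (simp_all add: related_refl)
    \<comment> \<open>The triple join links the two sides: it is related to the join of x and z, and
      also to the join of y and z, which is related to z.\<close>
    have "(x \<squnion> (y \<squnion> z), x \<squnion> z) \<in> \<theta>" by (rule related_join[OF refl(1) yz])
    moreover have "(x \<squnion> (y \<squnion> z), y \<squnion> z) \<in> \<theta>"
      using related_join[OF xy refl(2)] xyz by (simp add: join_assoc)
    ultimately have "(x \<squnion> z, z) \<in> \<theta>"
      using yz by (blast intro: related_sym related_trans)
    then show ?thesis using xyz by (simp add: le_quot_iff)
  qed
  have refl: "C \<sqsubseteq>\<^bsub>quot\<^esub> C" if "C \<in> carrier quot" for C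
    using that class_mono by (auto simp: carrier_quot)
  have eq: "eq quot = (=)" by (simp add: quotient_sup_lattice_def)
  show ?thesis
    by unfold_locales (simp_all add: eq refl, (rule antisym; assumption), (rule trans; assumption))
qed

text \<open>If the class of y is an upper bound, then for each x in A the join of x and y is related
  to y. Taking the join of all these relations shows that the join of \<open>\<Squnion>A\<close> and
  y is related to y, so the class of \<open>\<Squnion>A\<close> lies below that of y.\<close>

lemma least_quot:
  assumes A: "A \<subseteq> carrier L"
  shows "least quot (\<theta> `` {\<Squnion>A}) (Upper quot ((\<lambda>x. \<theta> `` {x}) ` A))"
proof -
  interpret quot: partial_order quot by (rule partial_order_quot)
  have sup: "\<Squnion>A \<in> carrier L" using A by simp
  show ?thesis
  proof (rule least_UpperI)
    show "C \<sqsubseteq>\<^bsub>quot\<^esub> \<theta> `` {\<Squnion>A}" if "C \<in> (\<lambda>x. \<theta> `` {x}) ` A" for C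
      using that A by (auto intro!: class_mono sup_upper)
    show "(\<lambda>x. \<theta> `` {x}) ` A \<subseteq> carrier quot" "\<theta> `` {\<Squnion>A} \<in> carrier quot"
      using A sup by (auto simp: carrier_quot)
    fix D assume D: "D \<in> Upper quot ((\<lambda>x. \<theta> `` {x}) ` A)"
    then have "D \<in> carrier quot" by (simp add: Upper_def)
    then obtain y where y: "y \<in> carrier L" "D = \<theta> `` {y}"
      by (auto simp: carrier_quot)
    have rel: "(x \<squnion> y, y) \<in> \<theta>" if "x \<in> A" for x
    proof -
      have "\<theta> `` {x} \<sqsubseteq>\<^bsub>quot\<^esub> D"
        using D that A by (auto simp: Upper_def carrier_quot)
      then show ?thesis using that A y by (simp add: le_quot_iff subsetD)
    qed
    have yy: "(y, y) \<in> \<theta>" by (rule related_refl[OF y(1)])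
    \<comment> \<open>The index \<open>None\<close> covers the case of empty \<open>A\<close>.\<close>
    let ?f = "case_option y (\<lambda>x. x \<squnion> y)" and ?J = "insert None (Some ` A)"
    have "(\<Squnion>(?f ` ?J), \<Squnion>((\<lambda>_. y) ` ?J)) \<in> \<theta>"
      by (rule related_sup_image) (use rel yy in auto)
    moreover have "\<Squnion>((\<lambda>_. y) ` ?J) = y"
      using y by (simp add: image_constant_conv)
    moreover have "\<Squnion>(?f ` ?J) = \<Squnion>A \<squnion> y"
    proof (rule sup_eqI)
      show "?f ` ?J \<subseteq> carrier L" "\<Squnion>A \<squnion> y \<in> carrier L" using A y sup by auto
      have "x \<squnion> y \<sqsubseteq> \<Squnion>A \<squnion> y" if "x \<in> A" for x
        using that A y sup
        by (intro join_le) (auto intro: le_trans[OF sup_upper[OF A that] join_left] join_right)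
      then show "x \<sqsubseteq> \<Squnion>A \<squnion> y" if "x \<in> ?f ` ?J" for x
        using that y sup by (auto intro: join_right)
      fix u assume u: "u \<in> carrier L" "\<And>x. x \<in> ?f ` ?J \<Longrightarrow> x \<sqsubseteq> u"
      have "y \<sqsubseteq> u" by (rule u(2)) (simp add: image_iff)
      moreover have "\<Squnion>A \<sqsubseteq> u"
      proof (rule sup_least[OF A u(1)])
        fix x assume x: "x \<in> A"
        have "x \<squnion> y \<sqsubseteq> u" by (rule u(2)) (use x in \<open>auto simp: image_iff\<close>)
        then show "x \<sqsubseteq> u"
          using x A y u(1) by (meson join_closed join_left le_trans subsetD)
      qed
      ultimately show "\<Squnion>A \<squnion> y \<sqsubseteq> u" using sup y u by (simp add: join_le)
    qed
    ultimately show "\<theta> `` {\<Squnion>A} \<sqsubseteq>\<^bsub>quot\<^esub> D"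
      using y sup by (simp add: le_quot_iff)
  qed
qed

lemma complete_lattice_quot: "complete_lattice quot"
proof (rule partial_order.complete_lattice_if_sups[OF partial_order_quot])
  fix B assume "B \<subseteq> carrier quot"
  then obtain A where "A \<subseteq> carrier L" "B = (\<lambda>x. \<theta> `` {x}) ` A"
    by (auto simp: carrier_quot subset_image_iff)
  then show "\<exists>s. least quot s (Upper quot B)" using least_quot by blast
qed

lemma sup_quot:
  assumes "A \<subseteq> carrier L"
  shows "\<Squnion>\<^bsub>quot\<^esub>((\<lambda>x. \<theta> `` {x}) ` A) = \<theta> `` {\<Squnion>A}"
proof -
  interpret quot: complete_lattice quot by (rule complete_lattice_quot)
  have "(\<lambda>x. \<theta> `` {x}) ` A \<subseteq> carrier quot"
    using assms by (auto simp: carrier_quot)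
  then show ?thesis
    by (rule quot.least_unique[OF quot.sup_lub least_quot[OF assms]])
qed

end

section \<open>Free sup-lattices\<close>

lemma complete_lattice_free_sup_lattice: "complete_lattice (free_sup_lattice A)"
proof -
  interpret partial_order "free_sup_lattice A"
    by unfold_locales (auto simp: free_sup_lattice_def)
  show ?thesis
  proof (rule complete_lattice_if_sups)
    fix \<X> assume "\<X> \<subseteq> carrier (free_sup_lattice A)"
    then have "least (free_sup_lattice A) (\<Union>\<X>) (Upper (free_sup_lattice A) \<X>)"
      by (simp add: free_sup_lattice_def least_def Upper_def Sup_le_iff) blast
    then show "\<exists>s. least (free_sup_lattice A) s (Upper (free_sup_lattice A) \<X>)" ..
  qed
qed

lemma sup_free_sup_lattice:
  assumes "\<X> \<subseteq> Pow A"
  shows "\<Squnion>\<^bsub>free_sup_lattice A\<^esub>\<X> = \<Union>\<X>"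
proof -
  interpret complete_lattice "free_sup_lattice A" by (rule complete_lattice_free_sup_lattice)
  show ?thesis
    by (rule sup_eqI) (use assms in \<open>auto simp: free_sup_lattice_def Sup_le_iff\<close>)
qed

text \<open>This is the existence half of freeness: a map on points extends to subsets by joining
  its values. Preservation of joins amounts to the join of a union being the join of the
  joins.\<close>

lemma sup_pres_free_sup_lattice:
  assumes N: "complete_lattice N" and f: "f \<in> A \<rightarrow> carrier N"
  shows "sup_pres (free_sup_lattice A) N (\<lambda>X. \<Squnion>\<^bsub>N\<^esub>(f ` X))"
proof -
  interpret N: complete_lattice N by fact
  have "\<Squnion>\<^bsub>N\<^esub>(f ` (\<Squnion>\<^bsub>free_sup_lattice A\<^esub>\<X>)) = \<Squnion>\<^bsub>N\<^esub>((\<lambda>X. \<Squnion>\<^bsub>N\<^esub>(f ` X)) ` \<X>)"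
    if \<X>: "\<X> \<subseteq> Pow A" for \<X>
  proof -
    have "f ` (\<Squnion>\<^bsub>free_sup_lattice A\<^esub>\<X>) = \<Union>((`) f ` \<X>)"
      using \<X> by (simp add: sup_free_sup_lattice image_Union)
    moreover have "\<Squnion>\<^bsub>N\<^esub>(\<Union>((`) f ` \<X>)) = \<Squnion>\<^bsub>N\<^esub>((\<lambda>X. \<Squnion>\<^bsub>N\<^esub>X) ` (`) f ` \<X>)"
      by (rule N.sup_Union) (use \<X> f in blast)
    ultimately show ?thesis by (simp add: image_image)
  qed
  then show ?thesis
    using N complete_lattice_free_sup_lattice by (auto simp: sup_pres_def free_sup_lattice_def)
qed

section \<open>Extension of scalars\<close>

lemma right_regular_simps [simp]:
  "carrier (right_regular R \<nu>) = carrier R"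
  "\<Squnion>\<^bsub>right_regular R \<nu>\<^esub>A = \<Squnion>\<^bsub>R\<^esub>A"
  "r \<star>\<^bsub>right_regular R \<nu>\<^esub> a = r \<cdot>\<^bsub>R\<^esub> \<nu> a"
  by (simp_all add: right_regular_def sup_def least_def Upper_def)

lemma restrict_scalars_simps [simp]:
  "carrier (restrict_scalars h N) = carrier N"
  "\<Squnion>\<^bsub>restrict_scalars h N\<^esub>A = \<Squnion>\<^bsub>N\<^esub>A"
  "a \<bullet>\<^bsub>restrict_scalars h N\<^esub> x = h a \<bullet>\<^bsub>N\<^esub> x"
  by (simp_all add: restrict_scalars_def sup_def least_def Upper_def)

lemma complete_lattice_restrict_scalars [simp]:
  "complete_lattice (restrict_scalars h N) \<longleftrightarrow> complete_lattice N"
  by (auto simp: restrict_scalars_def elim!: complete_lattice_gorder_cong)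

lemma sup_pres_restrict_scalars [simp]:
  "sup_pres L (restrict_scalars h N) f \<longleftrightarrow> sup_pres L N f"
  by (simp add: sup_pres_def)

lemma (in quantale) qmult_closed [simp]:
  "\<lbrakk>a \<in> carrier Q; b \<in> carrier Q\<rbrakk> \<Longrightarrow> a \<cdot> b \<in> carrier Q"
  using monoid.m_closed[OF qmonoid] by simp

lemma (in quantale) qone_closed [simp]: "qone Q \<in> carrier Q"
  using monoid.one_closed[OF qmonoid] by simp

lemma (in quantale) qmult_assoc:
  "\<lbrakk>a \<in> carrier Q; b \<in> carrier Q; c \<in> carrier Q\<rbrakk> \<Longrightarrow> (a \<cdot> b) \<cdot> c = a \<cdot> (b \<cdot> c)"
  using monoid.m_assoc[OF qmonoid] by simp

lemma (in quantale) qmult_one [simp]: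
  "a \<in> carrier Q \<Longrightarrow> qone Q \<cdot> a = a"
  "a \<in> carrier Q \<Longrightarrow> a \<cdot> qone Q = a"
  using monoid.l_one[OF qmonoid] monoid.r_one[OF qmonoid] by simp_all

lemma left_qmodule_restrict_scalars:
  assumes Q: "quantale Q" and h: "h \<in> quantale_hom Q R" and N: "left_qmodule R N"
  shows "left_qmodule Q (restrict_scalars h N)"
proof -
  interpret Q: quantale Q by fact
  interpret N: left_qmodule R N by fact
  have hc: "h a \<in> carrier R" if "a \<in> carrier Q" for a
    using h that by (auto simp: quantale_hom_def)
  have hm: "h (a \<cdot>\<^bsub>Q\<^esub> b) = h a \<cdot>\<^bsub>R\<^esub> h b" if "a \<in> carrier Q" "b \<in> carrier Q" for a b
    using h that by (auto simp: quantale_hom_def)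
  have h1: "h (qone Q) = qone R" using h by (simp add: quantale_hom_def)
  have hs: "h (\<Squnion>\<^bsub>Q\<^esub>A) = \<Squnion>\<^bsub>R\<^esub>(h ` A)" if "A \<subseteq> carrier Q" for A
    using h that by (simp add: quantale_hom_def sup_pres_sup)
  interpret N': complete_lattice "restrict_scalars h N"
    by (simp add: N.M.complete_lattice_axioms)
  have img: "h ` A \<subseteq> carrier R" if "A \<subseteq> carrier Q" for A
    using that hc by auto
  show ?thesis
    by unfold_locales
      (simp_all add: hc hm h1 hs img N.lact_closed N.lact_mult N.lact_one N.lact_Sup_right
        N.lact_Sup_left image_image)
qed

text \<open>\<open>compose\<close> agrees with the composite only on \<open>carrier M\<close>, so
  compatibility with the action requires the action to stay in that carrier. Stating this as
  \<open>closed\<close> makes the lemma applicable to \<open>extend_scalars\<close> through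
  \<open>act_E_closed\<close>.\<close>

lemma compose_qmodule_hom:
  assumes f: "f \<in> qmodule_hom Q M N" and g: "g \<in> qmodule_hom Q N P"
    and closed: "\<And>a x. a \<in> carrier Q \<Longrightarrow> x \<in> carrier M \<Longrightarrow> a \<bullet>\<^bsub>M\<^esub> x \<in> carrier M"
  shows "compose (carrier M) g f \<in> qmodule_hom Q M P"
proof -
  have "sup_pres M P (compose (carrier M) g f)"
    using f g by (intro sup_pres_compose[of _ N]) (auto simp: qmodule_hom_def)
  then show ?thesis
    using f g closed by (auto simp: qmodule_hom_def compose_eq Pi_iff PiE_iff extensional_def compose_def)
qed

section \<open>Tensor product and extension of scalars along one homomorphism\<close>

locale scalar_extension = M: left_qmodule Q M + R: quantale R
  for Q :: "'q quantale" and M :: "('q, 'm) left_qmodule" and R :: "'r quantale" +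
  fixes \<nu> :: "'q \<Rightarrow> 'r"
  assumes hom: "\<nu> \<in> quantale_hom Q R"
begin

lemma hom_closed [simp]: "a \<in> carrier Q \<Longrightarrow> \<nu> a \<in> carrier R"
  using hom by (auto simp: quantale_hom_def)

abbreviation F :: "('r \<times> 'm) set gorder"
  where "F \<equiv> free_sup_lattice (carrier R \<times> carrier M)"

abbreviation \<theta> :: "('r \<times> 'm) set rel"
  where "\<theta> \<equiv> tensor_congruence Q (right_regular R \<nu>) M"

abbreviation cls :: "('r \<times> 'm) set \<Rightarrow> ('r \<times> 'm) set set"
  where "cls X \<equiv> \<theta> `` {X}"

abbreviation E :: "('r, ('r \<times> 'm) set set) left_qmodule"
  where "E \<equiv> extend_scalars Q R \<nu> M"

abbreviation unit :: "'m \<Rightarrow> ('r \<times> 'm) set set"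
  where "unit \<equiv> extend_scalars_unit Q R \<nu> M"

lemma carrier_F: "carrier F = Pow (carrier R \<times> carrier M)"
  by (simp add: free_sup_lattice_def)

lemma sup_congruence_tensor: "sup_congruence F \<theta>"
  unfolding tensor_congruence_def right_regular_simps
proof (rule complete_lattice.sup_congruence_generated[OF complete_lattice_free_sup_lattice])
  show "tensor_relations Q (right_regular R \<nu>) M \<subseteq> carrier F \<times> carrier F"
    by (auto simp: tensor_relations_def carrier_F M.lact_closed)
qed

sublocale T: sup_lattice_quotient F \<theta>
  using complete_lattice_free_sup_lattice sup_congruence_tensor
  by (simp add: sup_lattice_quotient_def sup_lattice_quotient_axioms_def)

lemma E_gorder:
  "carrier E = carrier T.quot" "le E = le T.quot" "eq E = eq T.quot"
  by (simp_all add: extend_scalars_def tensor_product_def Let_def)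

lemma complete_lattice_E: "complete_lattice E"
  using T.complete_lattice_quot by (rule complete_lattice_gorder_cong) (simp_all add: E_gorder)

lemma carrier_E: "carrier E = cls ` Pow (carrier R \<times> carrier M)"
  by (simp add: E_gorder T.carrier_quot carrier_F)

lemma cls_closed [simp]: "X \<subseteq> carrier R \<times> carrier M \<Longrightarrow> cls X \<in> carrier E"
  by (auto simp: carrier_E)

lemma sup_cls:
  assumes "\<X> \<subseteq> Pow (carrier R \<times> carrier M)"
  shows "\<Squnion>\<^bsub>E\<^esub>(cls ` \<X>) = cls (\<Union>\<X>)"
proof -
  have "\<Squnion>\<^bsub>E\<^esub>(cls ` \<X>) = \<Squnion>\<^bsub>T.quot\<^esub>(cls ` \<X>)"
    by (rule sup_gorder_cong) (simp_all add: E_gorder)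
  then show ?thesis
    using assms T.sup_quot[of \<X>] by (simp add: carrier_F sup_free_sup_lattice)
qed

text \<open>A subset is the union of its singletons, so elementary tensors generate \<open>E\<close>
  under joins. A join-preserving map on \<open>E\<close> is therefore determined by its values on
  them.\<close>

lemma cls_eq_sup:
  assumes "X \<subseteq> carrier R \<times> carrier M"
  shows "cls X = \<Squnion>\<^bsub>E\<^esub>((\<lambda>p. cls {p}) ` X)"
  using sup_cls[of "(\<lambda>p. {p}) ` X"] assms by (auto simp: image_image)

lemma related_tensor:
  "\<lbrakk>A \<subseteq> carrier R; y \<in> carrier M\<rbrakk> \<Longrightarrow> ({(\<Squnion>\<^bsub>R\<^esub>A, y)}, (\<lambda>s. (s, y)) ` A) \<in> \<theta>"
  "\<lbrakk>s \<in> carrier R; Y \<subseteq> carrier M\<rbrakk> \<Longrightarrow> ({(s, \<Squnion>\<^bsub>M\<^esub>Y)}, (\<lambda>y. (s, y)) ` Y) \<in> \<theta>"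
  "\<lbrakk>s \<in> carrier R; a \<in> carrier Q; y \<in> carrier M\<rbrakk>
    \<Longrightarrow> ({(s \<cdot>\<^bsub>R\<^esub> \<nu> a, y)}, {(s, a \<bullet>\<^bsub>M\<^esub> y)}) \<in> \<theta>"
  unfolding tensor_congruence_def
  by (rule subsetD[OF generators_subset_generated_sup_congruence];
      unfold tensor_relations_def right_regular_simps; blast)+

lemma cls_eqI: "(X, Y) \<in> \<theta> \<Longrightarrow> cls X = cls Y"
  using T.equivalence by (rule equiv_class_eq)

lemma tensor_sup_left:
  assumes "A \<subseteq> carrier R" "y \<in> carrier M"
  shows "cls {(\<Squnion>\<^bsub>R\<^esub>A, y)} = \<Squnion>\<^bsub>E\<^esub>((\<lambda>s. cls {(s, y)}) ` A)"
  using cls_eqI[OF related_tensor(1)[OF assms]] cls_eq_sup[of "(\<lambda>s. (s, y)) ` A"] assms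
  by (auto simp: image_image)

lemma tensor_sup_right:
  assumes "s \<in> carrier R" "Y \<subseteq> carrier M"
  shows "cls {(s, \<Squnion>\<^bsub>M\<^esub>Y)} = \<Squnion>\<^bsub>E\<^esub>((\<lambda>y. cls {(s, y)}) ` Y)"
  using cls_eqI[OF related_tensor(2)[OF assms]] cls_eq_sup[of "(\<lambda>y. (s, y)) ` Y"] assms
  by (auto simp: image_image)

lemmas tensor_balanced = cls_eqI[OF related_tensor(3)]

text \<open>The kernel of the join-preserving extension of \<open>b\<close> to subsets is a
  sup-congruence. The assumptions \<open>left\<close>, \<open>right\<close> and
  \<open>balanced\<close> place the three kinds of generators in it, so it contains \<theta>. The
  lemma serves both for the action on \<open>E\<close> and for the maps out of
  \<open>E\<close>.\<close>

lemma bimorphism_respects_tensor: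
  assumes N: "complete_lattice N"
    and closed: "\<And>s y. s \<in> carrier R \<Longrightarrow> y \<in> carrier M \<Longrightarrow> b s y \<in> carrier N"
    and left: "\<And>A y. A \<subseteq> carrier R \<Longrightarrow> y \<in> carrier M
      \<Longrightarrow> b (\<Squnion>\<^bsub>R\<^esub>A) y = \<Squnion>\<^bsub>N\<^esub>((\<lambda>s. b s y) ` A)"
    and right: "\<And>s Y. s \<in> carrier R \<Longrightarrow> Y \<subseteq> carrier M
      \<Longrightarrow> b s (\<Squnion>\<^bsub>M\<^esub>Y) = \<Squnion>\<^bsub>N\<^esub>((\<lambda>y. b s y) ` Y)"
    and balanced: "\<And>s a y. s \<in> carrier R \<Longrightarrow> a \<in> carrier Q \<Longrightarrow> y \<in> carrier M
      \<Longrightarrow> b (s \<cdot>\<^bsub>R\<^esub> \<nu> a) y = b s (a \<bullet>\<^bsub>M\<^esub> y)"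
    and XY: "(X, Y) \<in> \<theta>"
  shows "\<Squnion>\<^bsub>N\<^esub>(case_prod b ` X) = \<Squnion>\<^bsub>N\<^esub>(case_prod b ` Y)"
proof -
  interpret N: complete_lattice N by fact
  let ?B = "\<lambda>X. \<Squnion>\<^bsub>N\<^esub>(case_prod b ` X)"
  let ?K = "{(X, Y). X \<in> carrier F \<and> Y \<in> carrier F \<and> ?B X = ?B Y}"
  have "sup_pres F N ?B"
    using N closed by (intro sup_pres_free_sup_lattice) auto
  then have "sup_congruence F ?K" by (rule sup_congruence_kernel)
  moreover have "tensor_relations Q (right_regular R \<nu>) M \<subseteq> ?K"
  proof -
    have "?B {(\<Squnion>\<^bsub>R\<^esub>A, y)} = ?B {(s, y) |s. s \<in> A}" if "A \<subseteq> carrier R" "y \<in> carrier M" for A y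
    proof -
      have "case_prod b ` {(s, y) |s. s \<in> A} = (\<lambda>s. b s y) ` A" by auto
      then show ?thesis using that by (simp add: closed left[symmetric])
    qed
    moreover have "?B {(s, \<Squnion>\<^bsub>M\<^esub>Y)} = ?B {(s, y) |y. y \<in> Y}"
      if "s \<in> carrier R" "Y \<subseteq> carrier M" for s Y
    proof -
      have "case_prod b ` {(s, y) |y. y \<in> Y} = b s ` Y" by auto
      then show ?thesis using that by (simp add: closed right[symmetric])
    qed
    ultimately show ?thesis
      unfolding tensor_relations_def right_regular_simps carrier_F
      by (auto simp: balanced M.lact_closed)
  qed
  ultimately have "\<theta> \<subseteq> ?K"
    unfolding tensor_congruence_def right_regular_simps by (rule generated_sup_congruence_least)
  then show ?thesis using XY by blast
qed

text \<open>The action is a union over all representatives. For fixed \<open>r\<close> the map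
  sending (s, x) to the tensor of \<open>r \<cdot> s\<close> and x is a balanced bimorphism, where
  balance is associativity in \<open>R\<close>. Hence all members of the union coincide.\<close>

lemma act_cls:
  assumes r: "r \<in> carrier R" and X: "X \<subseteq> carrier R \<times> carrier M"
  shows "r \<bullet>\<^bsub>E\<^esub> cls X = cls ((\<lambda>(s, x). (r \<cdot>\<^bsub>R\<^esub> s, x)) ` X)"
proof -
  let ?t = "\<lambda>X. (\<lambda>(s, x). (r \<cdot>\<^bsub>R\<^esub> s, x)) ` X"
  let ?b = "\<lambda>s x. cls {(r \<cdot>\<^bsub>R\<^esub> s, x)}"
  have img: "cls (?t Y) = \<Squnion>\<^bsub>E\<^esub>(case_prod ?b ` Y)" if "Y \<subseteq> carrier R \<times> carrier M" for Y
  proof -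
    have "?t Y \<subseteq> carrier R \<times> carrier M" using that r by auto
    then show ?thesis
      by (subst cls_eq_sup) (simp_all add: image_image case_prod_unfold)
  qed
  have "cls (?t Y) = cls (?t X)" if Y: "Y \<in> cls X" for Y
  proof -
    have XY: "(X, Y) \<in> \<theta>" using Y by simp
    have "\<Squnion>\<^bsub>E\<^esub>(case_prod ?b ` X) = \<Squnion>\<^bsub>E\<^esub>(case_prod ?b ` Y)"
    proof (rule bimorphism_respects_tensor[OF complete_lattice_E _ _ _ _ XY])
      show "?b s y \<in> carrier E" if "s \<in> carrier R" "y \<in> carrier M" for s y
        using that r by simp
      show "?b (\<Squnion>\<^bsub>R\<^esub>A) y = \<Squnion>\<^bsub>E\<^esub>((\<lambda>s. ?b s y) ` A)"
        if "A \<subseteq> carrier R" "y \<in> carrier M" for A y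
      proof -
        have "(\<lambda>s. r \<cdot>\<^bsub>R\<^esub> s) ` A \<subseteq> carrier R" using that r by auto
        then show ?thesis
          using that r by (simp add: R.qmult_Sup_right tensor_sup_left image_image)
      qed
      show "?b s (\<Squnion>\<^bsub>M\<^esub>Z) = \<Squnion>\<^bsub>E\<^esub>((\<lambda>y. ?b s y) ` Z)"
        if "s \<in> carrier R" "Z \<subseteq> carrier M" for s Z
        using that r by (simp add: tensor_sup_right)
      show "?b (s \<cdot>\<^bsub>R\<^esub> \<nu> a) y = ?b s (a \<bullet>\<^bsub>M\<^esub> y)"
        if "s \<in> carrier R" "a \<in> carrier Q" "y \<in> carrier M" for s a y
        using that r tensor_balanced[of "r \<cdot>\<^bsub>R\<^esub> s" a y] by (simp add: R.qmult_assoc)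
    qed
    moreover have "Y \<subseteq> carrier R \<times> carrier M"
      using T.related_carrier[OF XY] by (simp add: carrier_F)
    ultimately show ?thesis using X by (simp add: img)
  qed
  \<comment> \<open>The index set of the union must be inhabited, since an empty union would not
    give the common class.\<close>
  moreover have "X \<in> cls X" using X T.related_refl[of X] by (simp add: carrier_F)
  moreover have "r \<bullet>\<^bsub>E\<^esub> cls X = (\<Union>Y\<in>cls X. cls (?t Y))"
    by (simp add: extend_scalars_def Let_def)
  ultimately show ?thesis by blast
qed

lemma act_E_closed: "\<lbrakk>r \<in> carrier R; C \<in> carrier E\<rbrakk> \<Longrightarrow> r \<bullet>\<^bsub>E\<^esub> C \<in> carrier E"
  unfolding carrier_E by (fastforce simp: act_cls)

lemma unit_eq: "x \<in> carrier M \<Longrightarrow> unit x = cls {(qone R, x)}"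
  by (simp add: extend_scalars_unit_def elementary_tensor_def)

text \<open>Every elementary tensor is a scalar multiple of a value of \<open>unit\<close>, so an
  \<open>R\<close>-morphism on \<open>E\<close> is determined by its composite with
  \<open>unit\<close>.\<close>

lemma act_unit:
  "\<lbrakk>r \<in> carrier R; x \<in> carrier M\<rbrakk> \<Longrightarrow> r \<bullet>\<^bsub>E\<^esub> unit x = cls {(r, x)}"
  by (simp add: unit_eq act_cls)

lemma unit_hom: "unit \<in> qmodule_hom Q M (restrict_scalars \<nu> E)"
proof -
  have "unit \<in> carrier M \<rightarrow>\<^sub>E carrier E"
    by (rule PiE_I) (simp_all add: unit_eq, simp add: extend_scalars_unit_def)
  moreover have "unit (\<Squnion>\<^bsub>M\<^esub>Y) = \<Squnion>\<^bsub>E\<^esub>(unit ` Y)" if "Y \<subseteq> carrier M" for Y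
  proof -
    have "unit ` Y = (\<lambda>y. cls {(qone R, y)}) ` Y"
      using that by (intro image_cong) (auto simp: unit_eq)
    then show ?thesis using that by (simp add: unit_eq tensor_sup_right)
  qed
  moreover have "unit (a \<bullet>\<^bsub>M\<^esub> x) = \<nu> a \<bullet>\<^bsub>E\<^esub> unit x" if "a \<in> carrier Q" "x \<in> carrier M" for a x
    \<comment> \<open>Balance at the unit of \<open>R\<close> moves \<open>a\<close> across the
      tensor, because \<open>qone R\<close> times \<open>\<nu> a\<close> is
      \<open>\<nu> a\<close>.\<close>
    using that tensor_balanced[of "qone R" a x] by (simp add: act_unit) (simp add: unit_eq M.lact_closed)
  ultimately show ?thesis
    using M.M.complete_lattice_axioms complete_lattice_E by (simp add: qmodule_hom_def sup_pres_def)
qed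

text \<open>The value of \<open>g\<close> on each elementary tensor is forced by linearity, and
  joins force the rest. This gives uniqueness of the extension and dictates the formula by which it
  is constructed.\<close>

lemma hom_cls_eq_sup:
  assumes g: "g \<in> qmodule_hom R E N" and g_unit: "compose (carrier M) g unit = f"
    and X: "X \<subseteq> carrier R \<times> carrier M"
  shows "g (cls X) = \<Squnion>\<^bsub>N\<^esub>((\<lambda>(r, x). r \<bullet>\<^bsub>N\<^esub> f x) ` X)"
proof -
  have unit_closed: "unit x \<in> carrier E" if "x \<in> carrier M" for x
    using that by (simp add: unit_eq)
  have "g (cls {(r, x)}) = r \<bullet>\<^bsub>N\<^esub> f x" if "r \<in> carrier R" "x \<in> carrier M" for r x
  proof -
    have "g (cls {(r, x)}) = r \<bullet>\<^bsub>N\<^esub> g (unit x)"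
      using g that by (simp add: qmodule_hom_def unit_closed flip: act_unit)
    then show ?thesis using g_unit that by (auto simp: compose_eq)
  qed
  then have "(\<lambda>p. g (cls {p})) ` X = (\<lambda>(r, x). r \<bullet>\<^bsub>N\<^esub> f x) ` X"
    using X by (intro image_cong) auto
  moreover have "g (cls X) = \<Squnion>\<^bsub>N\<^esub>(g ` (\<lambda>p. cls {p}) ` X)"
    using g X unfolding cls_eq_sup[OF X]
    by (intro sup_pres_sup) (auto simp: qmodule_hom_def)
  ultimately show ?thesis by (simp add: image_image)
qed

theorem extension_of_scalars_universal:
  assumes N: "left_qmodule R N" and f: "f \<in> qmodule_hom Q M (restrict_scalars \<nu> N)"
  shows "\<exists>!g. g \<in> qmodule_hom R E N \<and> compose (carrier M) g unit = f"
proof (rule ex_ex1I)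
  interpret N: left_qmodule R N by fact
  let ?b = "\<lambda>r x. r \<bullet>\<^bsub>N\<^esub> f x"
  \<comment> \<open>\<open>B\<close> is the formula forced by \<open>hom_cls_eq_sup\<close>, read on
    subsets. The map \<open>g\<close> evaluates it at an arbitrary representative, and
    \<open>B_eq\<close> shows that the choice does not matter.\<close>
  define B where "B X = \<Squnion>\<^bsub>N\<^esub>(case_prod ?b ` X)" for X
  define g where "g = (\<lambda>C\<in>carrier E. B (SOME X. X \<in> C))"
  have f_closed: "f x \<in> carrier N" if "x \<in> carrier M" for x
    using f that by (auto simp: qmodule_hom_def)
  have f_act: "f (a \<bullet>\<^bsub>M\<^esub> x) = \<nu> a \<bullet>\<^bsub>N\<^esub> f x" if "a \<in> carrier Q" "x \<in> carrier M" for a x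
    using f that by (simp add: qmodule_hom_def)
  have f_sup: "f (\<Squnion>\<^bsub>M\<^esub>Y) = \<Squnion>\<^bsub>N\<^esub>(f ` Y)" if "Y \<subseteq> carrier M" for Y
    using f that by (simp add: qmodule_hom_def sup_pres_sup)
  have B_eq: "B X = B Y" if "(X, Y) \<in> \<theta>" for X Y
    unfolding B_def
  proof (rule bimorphism_respects_tensor[OF N.M.complete_lattice_axioms _ _ _ _ that])
    show "?b s y \<in> carrier N" if "s \<in> carrier R" "y \<in> carrier M" for s y
      using that by (simp add: N.lact_closed f_closed)
    show "?b (\<Squnion>\<^bsub>R\<^esub>A) y = \<Squnion>\<^bsub>N\<^esub>((\<lambda>s. ?b s y) ` A)" if "A \<subseteq> carrier R" "y \<in> carrier M" for A y
      using that by (simp add: N.lact_Sup_left f_closed)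
    show "?b s (\<Squnion>\<^bsub>M\<^esub>Y) = \<Squnion>\<^bsub>N\<^esub>((\<lambda>y. ?b s y) ` Y)" if "s \<in> carrier R" "Y \<subseteq> carrier M" for s Y
    proof -
      have "f ` Y \<subseteq> carrier N" using that f_closed by auto
      then show ?thesis using that by (simp add: f_sup N.lact_Sup_right image_image)
    qed
    \<comment> \<open>Balance is where the \<open>Q\<close>-linearity of \<open>f\<close> into the
      restricted module enters.\<close>
    show "?b (s \<cdot>\<^bsub>R\<^esub> \<nu> a) y = ?b s (a \<bullet>\<^bsub>M\<^esub> y)"
      if "s \<in> carrier R" "a \<in> carrier Q" "y \<in> carrier M" for s a y
      using that by (simp add: f_act N.lact_mult f_closed)
  qed
  have g_cls: "g (cls X) = B X" if X: "X \<subseteq> carrier R \<times> carrier M" for X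
  proof -
    have "X \<in> cls X" using X T.related_refl[of X] by (simp add: carrier_F)
    then have "(SOME Y. Y \<in> cls X) \<in> cls X" by (rule someI)
    then have "B (SOME Y. Y \<in> cls X) = B X" using B_eq by (metis Image_singleton_iff)
    then show ?thesis using X by (simp add: g_def)
  qed
  have b_closed: "case_prod ?b ` X \<subseteq> carrier N" if "X \<subseteq> carrier R \<times> carrier M" for X
    using that by (auto intro!: N.lact_closed f_closed)
  then have B_closed: "B X \<in> carrier N" if "X \<subseteq> carrier R \<times> carrier M" for X
    using that by (simp add: B_def)
  have "sup_pres E N g"
    unfolding sup_pres_def
  proof (intro conjI allI impI)
    show "complete_lattice E" "complete_lattice N"
      by (rule complete_lattice_E N.M.complete_lattice_axioms)+
    fix A assume "A \<subseteq> carrier E"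
    then obtain \<X> where \<X>: "\<X> \<subseteq> Pow (carrier R \<times> carrier M)" "A = cls ` \<X>"
      unfolding carrier_E subset_image_iff by blast
    have "g (\<Squnion>\<^bsub>E\<^esub>A) = B (\<Union>\<X>)"
      using \<X> by (simp add: sup_cls) (rule g_cls, blast)
    also have "\<dots> = \<Squnion>\<^bsub>N\<^esub>(B ` \<X>)"
    proof -
      have "sup_pres F N B"
        unfolding B_def using N.M.complete_lattice_axioms b_closed
        by (intro sup_pres_free_sup_lattice) blast+
      then show ?thesis
        using \<X>(1) sup_pres_sup[of F N B \<X>] by (simp add: carrier_F sup_free_sup_lattice)
    qed
    also have "B ` \<X> = g ` A"
      using \<X> by (auto simp: g_cls image_image intro!: image_cong)
    finally show "g (\<Squnion>\<^bsub>E\<^esub>A) = \<Squnion>\<^bsub>N\<^esub>(g ` A)" .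
  qed
  moreover have "g \<in> carrier E \<rightarrow>\<^sub>E carrier N"
  proof
    show "g C \<in> carrier N" if "C \<in> carrier E" for C
      using that B_closed g_cls by (auto simp: carrier_E)
    show "g C = undefined" if "C \<notin> carrier E" for C
      using that by (simp add: g_def)
  qed
  moreover have "g (r \<bullet>\<^bsub>E\<^esub> C) = r \<bullet>\<^bsub>N\<^esub> g C" if r: "r \<in> carrier R" and C: "C \<in> carrier E" for r C
  proof -
    obtain X where X: "X \<subseteq> carrier R \<times> carrier M" "C = cls X"
      using C by (auto simp: carrier_E)
    let ?tX = "(\<lambda>(s, x). (r \<cdot>\<^bsub>R\<^esub> s, x)) ` X"
    have tX: "?tX \<subseteq> carrier R \<times> carrier M" using X r by auto
    have "g (r \<bullet>\<^bsub>E\<^esub> C) = B ?tX"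
      using X r by (simp add: act_cls g_cls[OF tX])
    also have "case_prod ?b ` ?tX = (\<lambda>y. r \<bullet>\<^bsub>N\<^esub> y) ` case_prod ?b ` X"
      unfolding image_image
      by (rule image_cong) (use X r in \<open>auto simp: N.lact_mult f_closed\<close>)
    then have "B ?tX = r \<bullet>\<^bsub>N\<^esub> B X"
      unfolding B_def using N.lact_Sup_right[OF r b_closed[OF X(1)]] by simp
    finally show ?thesis using X by (simp add: g_cls)
  qed
  ultimately have "g \<in> qmodule_hom R E N" by (simp add: qmodule_hom_def)
  moreover have "compose (carrier M) g unit = f"
  proof (rule extensionalityI[of _ "carrier M"])
    show "f \<in> extensional (carrier M)" using f by (auto simp: qmodule_hom_def PiE_def)
    show "compose (carrier M) g unit x = f x" if "x \<in> carrier M" for x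
      using that by (simp add: compose_eq unit_eq g_cls B_def N.lact_one f_closed)
  qed simp
  ultimately show "\<exists>g. g \<in> qmodule_hom R E N \<and> compose (carrier M) g unit = f" by blast
next
  fix g g'
  assume g: "g \<in> qmodule_hom R E N \<and> compose (carrier M) g unit = f"
    and g': "g' \<in> qmodule_hom R E N \<and> compose (carrier M) g' unit = f"
  show "g = g'"
  proof (rule extensionalityI[of _ "carrier E"])
    show "g \<in> extensional (carrier E)" "g' \<in> extensional (carrier E)"
      using g g' by (auto simp: qmodule_hom_def PiE_def)
    show "g C = g' C" if "C \<in> carrier E" for C
      using that g g' by (auto simp: carrier_E hom_cls_eq_sup)
  qed
qed

end

section \<open>The coproduct in the category of modules over varying quantales\<close>

theorem theorem3p1:
  fixes I :: "'i set"
    and Q :: "'i \<Rightarrow> 'q quantale"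
    and M :: "'i \<Rightarrow> ('q, 'm) left_qmodule"
    and R :: "'r quantale"
    and \<nu> :: "'i \<Rightarrow> 'q \<Rightarrow> 'r"
    and P :: "('r, 'p) left_qmodule"
    and \<mu> :: "'i \<Rightarrow> ('r \<times> 'm) set set \<Rightarrow> 'p"
  assumes "\<And>i. i \<in> I \<Longrightarrow> QM_object (Q i, M i)"
    and "quantale_coproduct TYPE('s) I Q R \<nu>"
    and "qmodule_coproduct TYPE('n) R I (\<lambda>i. extend_scalars (Q i) R (\<nu> i) (M i)) P \<mu>"
  shows "QM_coproduct TYPE('s) TYPE('n) I (\<lambda>i. (Q i, M i)) (R, P)
           (\<lambda>i. (\<nu> i, compose (carrier (M i)) (\<mu> i) (extend_scalars_unit (Q i) R (\<nu> i) (M i))))"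
proof -
  let ?E = "\<lambda>i. extend_scalars (Q i) R (\<nu> i) (M i)"
  let ?unit = "\<lambda>i. extend_scalars_unit (Q i) R (\<nu> i) (M i)"
  let ?\<kappa> = "\<lambda>i. compose (carrier (M i)) (\<mu> i) (?unit i)"
  have R: "quantale R" and \<nu>: "\<And>i. i \<in> I \<Longrightarrow> \<nu> i \<in> quantale_hom (Q i) R"
    using assms(2) unfolding quantale_coproduct_def by blast+
  have P: "left_qmodule R P" and \<mu>: "\<And>i. i \<in> I \<Longrightarrow> \<mu> i \<in> qmodule_hom R (?E i) P"
    using assms(3) unfolding qmodule_coproduct_def by blast+
  have scal: "scalar_extension (Q i) (M i) R (\<nu> i)" if "i \<in> I" for i
    using assms(1)[OF that] R \<nu>[OF that]
    by (simp add: QM_object_def scalar_extension_def scalar_extension_axioms_def)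
  have act_closed: "a \<bullet>\<^bsub>?E i\<^esub> x \<in> carrier (?E i)"
    if "i \<in> I" "a \<in> carrier R" "x \<in> carrier (?E i)" for i a x
    using scalar_extension.act_E_closed[OF scal] that by blast
  have unit: "?unit i \<in> qmodule_hom (Q i) (M i) (restrict_scalars (\<nu> i) (?E i))" if "i \<in> I" for i
    by (rule scalar_extension.unit_hom[OF scal[OF that]])
  \<comment> \<open>Each \<open>compose\<close> truncates to a carrier, so associativity relies on
    the unit mapping \<open>carrier (M i)\<close> into \<open>carrier (?E i)\<close>.\<close>
  have assoc: "compose (carrier (M i)) g (?\<kappa> i)
      = compose (carrier (M i)) (compose (carrier (?E i)) g (\<mu> i)) (?unit i)" if "i \<in> I" for i and g :: "'p \<Rightarrow> 'n"
    using unit[OF that] by (auto simp: fun_eq_iff compose_def qmodule_hom_def)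
  have \<kappa>: "?\<kappa> i \<in> qmodule_hom (Q i) (M i) (restrict_scalars (\<nu> i) P)" if i: "i \<in> I" for i
  proof -
    interpret M: left_qmodule "Q i" "M i"
      using assms(1)[OF i] by (simp add: QM_object_def)
    have "\<nu> i a \<in> carrier R" if "a \<in> carrier (Q i)" for a
      using \<nu>[OF i] that by (auto simp: quantale_hom_def)
    \<comment> \<open>An \<open>R\<close>-morphism stays linear when source and target are both
      restricted along \<open>\<nu> i\<close>.\<close>
    then have "\<mu> i \<in> qmodule_hom (Q i) (restrict_scalars (\<nu> i) (?E i)) (restrict_scalars (\<nu> i) P)"
      using \<mu>[OF i] by (simp add: qmodule_hom_def sup_pres_def)
    then show ?thesis
      using compose_qmodule_hom[OF unit[OF i]] M.lact_closed by blast
  qed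
  show ?thesis
    unfolding QM_coproduct_def
  proof (intro conjI allI impI ballI)
    show "QM_object (R, P)" using R P by (simp add: QM_object_def)
    show "(\<nu> i, ?\<kappa> i) \<in> QM_hom (Q i, M i) (R, P)" if "i \<in> I" for i
      using that \<nu> \<kappa> by (simp add: QM_hom_def)
    fix C :: "'s quantale \<times> ('s, 'n) left_qmodule" and u
    assume Cu: "QM_object C \<and> (\<forall>i\<in>I. u i \<in> QM_hom (Q i, M i) C)"
    obtain S N where C: "C = (S, N)" by (cases C)
    define h where "h i = fst (u i)" for i
    define f where "f i = snd (u i)" for i
    have S: "quantale S" and N: "left_qmodule S N"
      using Cu by (simp_all add: C QM_object_def)
    have h: "h i \<in> quantale_hom (Q i) S"
      and f: "f i \<in> qmodule_hom (Q i) (M i) (restrict_scalars (h i) N)" if "i \<in> I" for i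
      using Cu that by (auto simp: C QM_hom_def h_def f_def)
    let ?K = "\<lambda>k. k \<in> quantale_hom R S \<and> (\<forall>i\<in>I. compose (carrier (Q i)) k (\<nu> i) = h i)"
    have ex1_k: "\<exists>!k. ?K k"
      using assms(2) S h unfolding quantale_coproduct_def by blast
    then obtain k where "?K k" by blast
    then have k: "k \<in> quantale_hom R S"
        "\<And>i. i \<in> I \<Longrightarrow> compose (carrier (Q i)) k (\<nu> i) = h i"
      by simp_all
    let ?N = "restrict_scalars k N"
    have N': "left_qmodule R ?N"
      by (rule left_qmodule_restrict_scalars[OF R k(1) N])
    \<comment> \<open>The restriction along \<open>h i\<close> and the iterated one along
      \<open>k\<close> and \<open>\<nu> i\<close> have actions that agree for scalars in
      \<open>carrier (Q i)\<close>, but possibly not elsewhere. The transfer is therefore made for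
      morphisms and not by equating the two records.\<close>
    have f': "f i \<in> qmodule_hom (Q i) (M i) (restrict_scalars (\<nu> i) ?N)" if "i \<in> I" for i
    proof -
      have "h i a = k (\<nu> i a)" if "a \<in> carrier (Q i)" for a
        using fun_cong[OF k(2)[OF \<open>i \<in> I\<close>], of a] that by (simp add: compose_eq)
      then show ?thesis using f[OF that] by (simp add: qmodule_hom_def)
    qed
    let ?\<Phi> = "\<lambda>i g. g \<in> qmodule_hom R (?E i) ?N \<and> compose (carrier (M i)) g (?unit i) = f i"
    have ex1_\<phi>: "\<exists>!g. ?\<Phi> i g" if "i \<in> I" for i
      by (rule scalar_extension.extension_of_scalars_universal[OF scal[OF that] N' f'[OF that]])
    \<comment> \<open>The universal property of \<open>P\<close> takes a whole family, so the unique
      extensions are collected into one function of \<open>i\<close>.\<close>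
    define \<phi> where "\<phi> i = (THE g. ?\<Phi> i g)" for i
    have \<phi>: "?\<Phi> i (\<phi> i)" if "i \<in> I" for i
      unfolding \<phi>_def by (rule theI'[OF ex1_\<phi>[OF that]])
    let ?G = "\<lambda>g. g \<in> qmodule_hom R P ?N \<and> (\<forall>i\<in>I. compose (carrier (?E i)) g (\<mu> i) = \<phi> i)"
    have ex1_g: "\<exists>!g. ?G g"
      using assms(3) N' \<phi> unfolding qmodule_coproduct_def by blast
    then obtain g where g: "?G g" by blast
    show "\<exists>!w. w \<in> QM_hom (R, P) C \<and>
        (\<forall>i\<in>I. QM_compose (Q i, M i) w (\<nu> i, ?\<kappa> i) = u i)"
    proof (rule ex1I[of _ "(k, g)"])
      show "(k, g) \<in> QM_hom (R, P) C \<and>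
          (\<forall>i\<in>I. QM_compose (Q i, M i) (k, g) (\<nu> i, ?\<kappa> i) = u i)"
        using k g \<phi> by (simp add: QM_hom_def QM_compose_def C assoc h_def f_def)
      fix w
      assume w: "w \<in> QM_hom (R, P) C \<and>
        (\<forall>i\<in>I. QM_compose (Q i, M i) w (\<nu> i, ?\<kappa> i) = u i)"
      obtain k' g' where w_eq: "w = (k', g')" by (cases w)
      have k': "k' \<in> quantale_hom R S" and g': "g' \<in> qmodule_hom R P (restrict_scalars k' N)"
        using w by (simp_all add: w_eq QM_hom_def C)
      have comp: "compose (carrier (Q i)) k' (\<nu> i) = h i"
        "compose (carrier (M i)) g' (?\<kappa> i) = f i" if "i \<in> I" for i
        using bspec[OF conjunct2[OF w] that]
        by (simp_all add: w_eq QM_compose_def h_def f_def prod_eq_iff)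
      \<comment> \<open>The quantale component has to be settled first: the module structure on the
        target of \<open>g'\<close> depends on \<open>k'\<close>, and the uniqueness of
        \<open>g\<close> concerns morphisms into the restriction along \<open>k\<close>.\<close>
      have "k' = k" using ex1_k k k' comp(1) by blast
      moreover from this g' have g': "g' \<in> qmodule_hom R P ?N" by simp
      \<comment> \<open>Composing with the unit gives \<open>f i\<close>, so uniqueness in the
        extension of scalars identifies this \<open>R\<close>-morphism with \<open>\<phi> i\<close>.
        Then \<open>g'\<close> satisfies the condition that characterizes \<open>g\<close>.\<close>
      have "compose (carrier (?E i)) g' (\<mu> i) = \<phi> i" if i: "i \<in> I" for i
      proof -
        have "compose (carrier (?E i)) g' (\<mu> i) \<in> qmodule_hom R (?E i) ?N"
          by (rule compose_qmodule_hom[OF \<mu>[OF i] g' act_closed[OF i]])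
        moreover have "compose (carrier (M i)) (compose (carrier (?E i)) g' (\<mu> i)) (?unit i) = f i"
          using comp(2)[OF i] assoc[OF i] by simp
        ultimately show ?thesis using ex1_\<phi>[OF i] \<phi>[OF i] by blast
      qed
      then have "g' = g" using ex1_g g g' by blast
      ultimately show "w = (k, g)" by (simp add: w_eq)
    qed
  qed
qed

end
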